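(* Fix a positive integer $k_A$. There exist positive constants $C_1(k_A)$ and $C_2(k_A)$ such that for all positive integers $k_B$, $\Delta_A$, $\Delta_B$ with $\Delta_A \geq k_A$ and $\Delta_B \geq k_B$, the complete bipartite graph $G = K_{\Delta_B, \Delta_A}$ is $(k_A, k_B)$-choosable whenever $\xi < C_1(k_A)$, and is not $(k_A, k_B)$-choosable whenever $\xi > C_2(k_A)$, where $\xi = \Delta_B (\log \Delta_A)^{k_A-1}/k_B^{k_A}$.
   Context: All graphs are finite and simple. For a bipartite graph $G$ with bipartition $V = A \sqcup B$ and positive integers $k_A, k_B$, $G$ is $(k_A,k_B)$-choosable if for every set of colors $C$ and every list assignment $L$ assigning to each vertex of $A$ a $k_A$-element subset of $C$ and to each vertex of $B$ a $k_B$-element subset of $C$, there is a map $c\colon V\to C$ with $c(v)\in L(v)$ for all $v$ and $c(v)\neq c(v')$ for every edge $vv'$. $\Delta_A$ (resp. $\Delta_B$) denotes the maximum degree of a vertex in $A$ (resp. $B$). For the complete bipartite graph $K_{\Delta_B,\Delta_A}$ the part $A$ has $\Delta_B$ vertices and the part $B$ has $\Delta_A$ vertices (so vertices of $A$ have degree $\Delta_A$ and vertices of $B$ have degree $\Delta_B$). $\log$ is the natural logarithm, with the convention $(\log x)^0 = 1$. *)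

theory Defs
  imports Complex_Main
begin

definition bipartite_graph :: "'v set \<Rightarrow> 'v set \<Rightarrow> 'v set set \<Rightarrow> bool" where
  "bipartite_graph A B E \<longleftrightarrow>
     finite A \<and> finite B \<and> A \<inter> B = {} \<and> (\<forall>e\<in>E. \<exists>a\<in>A. \<exists>b\<in>B. e = {a, b})"

definition list_assignment ::
    "'v set \<Rightarrow> 'v set \<Rightarrow> nat \<Rightarrow> nat \<Rightarrow> 'c set \<Rightarrow> ('v \<Rightarrow> 'c set) \<Rightarrow> bool" where
  "list_assignment A B kA kB C L \<longleftrightarrow>
     (\<forall>v\<in>A. L v \<subseteq> C \<and> finite (L v) \<and> card (L v) = kA) \<and>
     (\<forall>v\<in>B. L v \<subseteq> C \<and> finite (L v) \<and> card (L v) = kB)"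

definition list_colouring ::
    "'v set \<Rightarrow> 'v set set \<Rightarrow> ('v \<Rightarrow> 'c set) \<Rightarrow> ('v \<Rightarrow> 'c) \<Rightarrow> bool" where
  "list_colouring V E L c \<longleftrightarrow>
     (\<forall>v\<in>V. c v \<in> L v) \<and> (\<forall>u v. {u, v} \<in> E \<longrightarrow> c u \<noteq> c v)"

(* A definition in HOL cannot quantify over the type of colours, so the colour sets C
   range over the subsets of nat.  Since the graph and all lists are finite this is no
   restriction: see choosable_any_colours below. *)
definition choosable :: "'v set \<Rightarrow> 'v set \<Rightarrow> 'v set set \<Rightarrow> nat \<Rightarrow> nat \<Rightarrow> bool" where
  "choosable A B E kA kB \<longleftrightarrow>
     (\<forall>(C :: nat set) L. list_assignment A B kA kB C L \<longrightarrow>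
        (\<exists>c. list_colouring (A \<union> B) E L c))"

lemma choosable_any_colours:
  fixes A B :: "'v set" and C :: "'c set"
  assumes G: "bipartite_graph A B E" and ch: "choosable A B E kA kB"
    and L: "list_assignment A B kA kB C L"
  shows "\<exists>c. list_colouring (A \<union> B) E L c"
proof -
  define S where "S = (\<Union>v\<in>A \<union> B. L v)"
  have "finite S"
    using G L unfolding S_def bipartite_graph_def list_assignment_def by auto
  then obtain f :: "'c \<Rightarrow> nat" where f: "inj_on f S"
    using finite_imp_inj_to_nat_seg by blast
  have sub: "L v \<subseteq> S" if "v \<in> A \<union> B" for v
    using that by (auto simp: S_def)
  have card: "card (f ` L v) = card (L v)" if "v \<in> A \<union> B" for v
    using sub[OF that] f by (meson card_image inj_on_subset)
  have "list_assignment A B kA kB UNIV (\<lambda>v. f ` L v)"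
    using L card unfolding list_assignment_def by auto
  then obtain c where c: "list_colouring (A \<union> B) E (\<lambda>v. f ` L v) c"
    using ch unfolding choosable_def by blast
  have img: "c v \<in> f ` L v" if "v \<in> A \<union> B" for v
    using c that unfolding list_colouring_def by blast
  have mem: "inv_into S f (c v) \<in> L v" if "v \<in> A \<union> B" for v
    using img[OF that] sub[OF that] f by (auto simp: inv_into_f_f subset_iff)
  have f_inv: "f (inv_into S f (c v)) = c v" if "v \<in> A \<union> B" for v
    using img[OF that] sub[OF that] by (intro f_inv_into_f) auto
  have "inv_into S f (c u) \<noteq> inv_into S f (c v)" if e: "{u, v} \<in> E" for u v
  proof -
    obtain a b where "a \<in> A" "b \<in> B" "{u, v} = {a, b}"
      using G e unfolding bipartite_graph_def by meson
    then have "u \<in> A \<union> B" "v \<in> A \<union> B"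
      by (auto simp: doubleton_eq_iff)
    moreover have "c u \<noteq> c v"
      using c e unfolding list_colouring_def by blast
    ultimately show ?thesis using f_inv[of u] f_inv[of v] by auto
  qed
  then have "list_colouring (A \<union> B) E L (\<lambda>v. inv_into S f (c v))"
    using mem unfolding list_colouring_def by blast
  then show ?thesis by blast
qed

definition K_left :: "nat \<Rightarrow> (nat + nat) set" where
  "K_left m = Inl ` {..<m}"

definition K_right :: "nat \<Rightarrow> (nat + nat) set" where
  "K_right n = Inr ` {..<n}"

definition K_edges :: "nat \<Rightarrow> nat \<Rightarrow> (nat + nat) set set" where
  "K_edges m n = {{a, b} | a b. a \<in> K_left m \<and> b \<in> K_right n}"

lemma bipartite_graph_K: "bipartite_graph (K_left m) (K_right n) (K_edges m n)"
  unfolding bipartite_graph_def K_left_def K_right_def K_edges_def by auto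

lemma card_K_left: "card (K_left m) = m"
  by (simp add: K_left_def card_image)

lemma card_K_right: "card (K_right n) = n"
  by (simp add: K_right_def card_image)

(* Choosability of the complete bipartite graph with parts of sizes m and n, where the
   first part (size m) plays the role of A and the second (size n) the role of B. *)
definition K_choosable :: "nat \<Rightarrow> nat \<Rightarrow> nat \<Rightarrow> nat \<Rightarrow> bool" where
  "K_choosable m n kA kB \<longleftrightarrow> choosable (K_left m) (K_right n) (K_edges m n) kA kB"

end

theory Submission
  imports Defs "HOL-Library.FuncSet"
begin

text \<open>
  A complete bipartite graph is colourable from given lists iff some colour set $T$ (the colours
  reserved for $B$) contains no list of $A$ and meets every list of $B$. Write $n = \Delta_A$.

  If $\xi$ is small, put each colour into $T$ with probability $p = 8 \ln n / k_B$: then every list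
  of $B$ receives more than $\log_2 n$ colours of $T$, while $T$ contains fewer than $\log_2 n$
  lists of $A$, so one can delete a colour of each of the latter. This deletion step is what saves
  a factor $\ln n$ over the union bound.

  If $\xi$ is large, split the colours into $g \approx \log_{k_A} n$ groups of $k_A$ blocks of about
  $k_B / g$ colours. The lists of $A$ are the $k_A$-subsets of the groups, and the lists of $B$
  lie in the unions of one block per group. A set containing no list of $A$ misses a block of
  every group, hence misses a list of $B$.
\<close>

subsection \<open>Random subsets\<close>

text \<open>For \<open>T\<close> inside \<open>U\<close>, this is the probability of drawing
  \<open>T\<close> when each element is kept independently with probability \<open>p\<close>.
  Expectations thus become finite sums over \<open>Pow U\<close>.\<close>

definition subset_weight :: "real \<Rightarrow> 'a set \<Rightarrow> 'a set \<Rightarrow> real" where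
  "subset_weight p U T = p ^ card T * (1 - p) ^ card (U - T)"

lemma subset_weight_nonneg: "0 \<le> p \<Longrightarrow> p \<le> 1 \<Longrightarrow> 0 \<le> subset_weight p U T"
  by (simp add: subset_weight_def)

text \<open>Independence: when the right-hand product is multiplied out, \<open>T\<close> records
  the elements at which the first summand is chosen.\<close>

lemma expectation_prod:
  fixes f g :: "'a \<Rightarrow> real"
  assumes "finite U"
  shows "(\<Sum>T\<in>Pow U. subset_weight p U T * (prod f T * prod g (U - T)))
    = (\<Prod>x\<in>U. p * f x + (1 - p) * g x)"
  unfolding prod_add[OF assms]
  by (intro sum.cong) (simp_all add: subset_weight_def prod.distrib)

lemma sum_subset_weight: "finite U \<Longrightarrow> (\<Sum>T\<in>Pow U. subset_weight p U T) = 1"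
  using expectation_prod[of U p "\<lambda>_. 1" "\<lambda>_. 1"] by simp

text \<open>An exponential moment; with \<open>q = 1/2\<close> it gives a Chernoff-type bound
  against \<open>T\<close> having few elements in \<open>Y\<close>.\<close>

lemma expectation_power_card:
  fixes q :: real
  assumes "finite U" "Y \<subseteq> U"
  shows "(\<Sum>T\<in>Pow U. subset_weight p U T * q ^ card (T \<inter> Y)) = (1 - p * (1 - q)) ^ card Y"
proof -
  let ?f = "\<lambda>x. if x \<in> Y then q else 1"
  have "prod ?f T = q ^ card (T \<inter> Y)" if "T \<in> Pow U" for T
    using that finite_subset[of T U] assms by (simp add: prod.If_cases)
  then have "(\<Sum>T\<in>Pow U. subset_weight p U T * q ^ card (T \<inter> Y))
      = (\<Sum>T\<in>Pow U. subset_weight p U T * (prod ?f T * prod (\<lambda>_. 1) (U - T)))"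
    by (intro sum.cong) auto
  also have "\<dots> = (\<Prod>x\<in>U. p * ?f x + (1 - p) * 1)"
    by (rule expectation_prod[OF assms(1)])
  also have "\<dots> = (\<Prod>x\<in>U. if x \<in> Y then 1 - p * (1 - q) else 1)"
    by (intro prod.cong) (auto simp: algebra_simps)
  also have "\<dots> = (1 - p * (1 - q)) ^ card Y"
    using assms by (simp add: prod.If_cases Int_absorb1)
  finally show ?thesis .
qed

lemma probability_superset:
  assumes "finite U" "X \<subseteq> U"
  shows "(\<Sum>T\<in>Pow U. subset_weight p U T * (if X \<subseteq> T then 1 else 0)) = p ^ card X"
proof -
  let ?g = "\<lambda>x. if x \<in> X then 0 else 1 :: real"
  have "prod ?g (U - T) = (if X \<subseteq> T then 1 else 0)" if "T \<in> Pow U" for T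
  proof (cases "X \<subseteq> T")
    case True
    then show ?thesis by (auto intro!: prod.neutral)
  next
    case False
    then show ?thesis using assms that by (auto intro!: prod_zero)
  qed
  then have "(\<Sum>T\<in>Pow U. subset_weight p U T * (if X \<subseteq> T then 1 else 0))
      = (\<Sum>T\<in>Pow U. subset_weight p U T * (prod (\<lambda>_. 1) T * prod ?g (U - T)))"
    by (intro sum.cong) auto
  also have "\<dots> = (\<Prod>x\<in>U. p * 1 + (1 - p) * ?g x)"
    by (rule expectation_prod[OF assms(1)])
  also have "\<dots> = (\<Prod>x\<in>U. if x \<in> X then p else 1)"
    by (intro prod.cong) auto
  also have "\<dots> = p ^ card X"
    using assms by (simp add: prod.If_cases Int_absorb1)
  finally show ?thesis .
qed

text \<open>The left side of \<open>small\<close> is the expectation of a potential that controls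
  both families at once. A set with potential below 1 is then repaired by deleting a few
  points.\<close>

lemma exists_separating_set:
  fixes X :: "'i \<Rightarrow> 'c set" and Y :: "'j \<Rightarrow> 'c set" and p t :: real
  assumes fin: "finite U" "finite I" "finite J"
    and X: "\<And>i. i \<in> I \<Longrightarrow> X i \<subseteq> U \<and> card (X i) = k"
    and Y: "\<And>j. j \<in> J \<Longrightarrow> Y j \<subseteq> U \<and> card (Y j) = b"
    and "k > 0" "0 \<le> p" "p \<le> 1" "t > 0"
    and small: "real (card J) * 2 powr t * (1 - p / 2) ^ b + real (card I) * p ^ k / t < 1"
  obtains T where "\<And>i. i \<in> I \<Longrightarrow> \<not> X i \<subseteq> T" "\<And>j. j \<in> J \<Longrightarrow> T \<inter> Y j \<noteq> {}"
proof -
  let ?w = "subset_weight p U"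
  define bad where "bad T = {i \<in> I. X i \<subseteq> T}" for T
  \<comment> \<open>If \<open>pot T < 1\<close>, then \<open>T\<close> contains fewer than \<open>t\<close> of the \<open>X i\<close>
    but has more than \<open>t\<close> elements in each \<open>Y j\<close>.\<close>
  define pot where "pot T = (\<Sum>j\<in>J. 2 powr t * (1/2) ^ card (T \<inter> Y j)) + real (card (bad T)) / t" for T
  have fin_bad: "finite (bad T)" for T
    using fin by (simp add: bad_def)
  have card_bad: "real (card (bad T)) = (\<Sum>i\<in>I. if X i \<subseteq> T then 1 else 0)" for T
    using fin by (simp add: bad_def sum.If_cases Int_def)
  have "(\<Sum>T\<in>Pow U. ?w T * pot T)
      = (\<Sum>T\<in>Pow U. (\<Sum>j\<in>J. 2 powr t * (?w T * (1/2) ^ card (T \<inter> Y j)))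
          + (\<Sum>i\<in>I. ?w T * (if X i \<subseteq> T then 1 else 0)) / t)"
    by (intro sum.cong)
       (simp_all add: pot_def card_bad ring_distribs sum_distrib_left sum_divide_distrib mult_ac)
  also have "\<dots> = (\<Sum>j\<in>J. 2 powr t * (\<Sum>T\<in>Pow U. ?w T * (1/2) ^ card (T \<inter> Y j)))
          + (\<Sum>i\<in>I. \<Sum>T\<in>Pow U. ?w T * (if X i \<subseteq> T then 1 else 0)) / t"
    unfolding sum.distrib sum_divide_distrib[symmetric] sum_distrib_left
    by (simp only: sum.swap[of _ J] sum.swap[of _ I])
  also have "\<dots> = (\<Sum>j\<in>J. 2 powr t * (1 - p / 2) ^ b) + (\<Sum>i\<in>I. p ^ k) / t"
    using X Y fin expectation_power_card[of U _ p "1/2"] probability_superset[of U _ p] by simp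
  also have "\<dots> < 1"
    using small by simp
  also have "1 = (\<Sum>T\<in>Pow U. ?w T * 1)"
    using sum_subset_weight[OF fin(1)] by simp
  \<comment> \<open>A weighted average below 1 has a term below its weight; strictness lets the
    nonnegative weight be cancelled.\<close>
  finally have "\<exists>T\<in>Pow U. ?w T * pot T < ?w T * 1"
    by (meson not_less sum_mono)
  then obtain T where "T \<subseteq> U" "?w T * pot T < ?w T * 1"
    by blast
  then have "pot T < 1"
    using subset_weight_nonneg[of p U T] \<open>0 \<le> p\<close> \<open>p \<le> 1\<close> by (simp only: mult_less_cancel_left)
  have "finite T"
    using \<open>T \<subseteq> U\<close> fin finite_subset by blast
  have nonneg: "0 \<le> (\<Sum>j\<in>J. 2 powr t * (1/2) ^ card (T \<inter> Y j))"
    by (intro sum_nonneg) simp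
  have few_bad: "real (card (bad T)) < t"
  proof -
    have "real (card (bad T)) / t < 1"
      using \<open>pot T < 1\<close> nonneg by (simp add: pot_def)
    then show ?thesis using \<open>t > 0\<close> by simp
  qed
  have many_hits: "t < card (T \<inter> Y j)" if "j \<in> J" for j
  proof -
    have "2 powr t * (1/2) ^ card (T \<inter> Y j) \<le> (\<Sum>j\<in>J. 2 powr t * (1/2) ^ card (T \<inter> Y j))"
      using that fin by (intro member_le_sum) auto
    also have "\<dots> < 1"
    proof -
      have "0 \<le> real (card (bad T)) / t"
        using \<open>t > 0\<close> by simp
      then show ?thesis
        using \<open>pot T < 1\<close> unfolding pot_def by linarith
    qed
    finally have "2 powr t < 2 powr real (card (T \<inter> Y j))"
      by (simp add: powr_realpow power_one_over field_simps)
    then show ?thesis by simp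
  qed
  \<comment> \<open>Deleting one point of each contained \<open>X i\<close> costs fewer than
    \<open>t\<close> points of \<open>T\<close>, while every \<open>Y j\<close> meets
    \<open>T\<close> in more than \<open>t\<close>.\<close>
  define x where "x i = (SOME c. c \<in> X i)" for i
  have x: "x i \<in> X i" if "i \<in> I" for i
    using X[OF that] \<open>k > 0\<close> unfolding x_def some_in_eq by auto
  show ?thesis
  proof (rule that)
    show "\<not> X i \<subseteq> T - x ` bad T" if "i \<in> I" for i
      using x[OF that] that by (auto simp: bad_def)
    show "(T - x ` bad T) \<inter> Y j \<noteq> {}" if "j \<in> J" for j
    proof
      assume "(T - x ` bad T) \<inter> Y j = {}"
      then have "card (T \<inter> Y j) \<le> card (x ` bad T)"
        using fin_bad by (intro card_mono) auto
      also have "\<dots> \<le> card (bad T)"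
        using fin_bad by (rule card_image_le)
      finally show False
        using many_hits[OF that] few_bad by linarith
    qed
  qed
qed

subsection \<open>Colourings of complete bipartite graphs\<close>

text \<open>Left vertices take colours outside \<open>T\<close> and right vertices colours inside
  \<open>T\<close>, so the ends of an edge always differ.\<close>

lemma K_choosableI:
  assumes sep: "\<And>L :: nat + nat \<Rightarrow> nat set.
      list_assignment (K_left m) (K_right n) k b UNIV L \<Longrightarrow>
      \<exists>T. (\<forall>v\<in>K_left m. \<not> L v \<subseteq> T) \<and> (\<forall>v\<in>K_right n. T \<inter> L v \<noteq> {})"
  shows "K_choosable m n k b"
  unfolding K_choosable_def choosable_def
proof (intro allI impI)
  fix C :: "nat set" and L :: "nat + nat \<Rightarrow> nat set"
  assume "list_assignment (K_left m) (K_right n) k b C L"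
  then have "list_assignment (K_left m) (K_right n) k b UNIV L"
    by (simp add: list_assignment_def)
  from sep[OF this] obtain T
    where T: "\<And>v. v \<in> K_left m \<Longrightarrow> \<exists>c. c \<in> L v - T" "\<And>v. v \<in> K_right n \<Longrightarrow> \<exists>c. c \<in> L v \<inter> T"
    by blast
  have "\<exists>c. if v \<in> K_left m then c \<in> L v - T else v \<in> K_right n \<longrightarrow> c \<in> L v \<inter> T" for v
    using T by auto
  then obtain c where c: "\<And>v. if v \<in> K_left m then c v \<in> L v - T else v \<in> K_right n \<longrightarrow> c v \<in> L v \<inter> T"
    by metis
  have disj: "K_left m \<inter> K_right n = {}"
    by (auto simp: K_left_def K_right_def)
  have "c u \<noteq> c v" if edge: "{u, v} \<in> K_edges m n" for u v
  proof -
    obtain x y where "x \<in> K_left m" "y \<in> K_right n" "{u, v} = {x, y}"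
      using edge unfolding K_edges_def by blast
    then show ?thesis
      using c[of u] c[of v] disj by (auto simp: doubleton_eq_iff split: if_splits)
  qed
  moreover have "c v \<in> L v" if "v \<in> K_left m \<union> K_right n" for v
    using c[of v] that by (auto split: if_splits)
  ultimately show "\<exists>c. list_colouring (K_left m \<union> K_right n) (K_edges m n) L c"
    unfolding list_colouring_def by blast
qed

text \<open>Lets a family with fewer sets than vertices serve as the lists of a part: surplus
  vertices repeat one member.\<close>

lemma finite_surj_lessThan:
  assumes "finite F" "F \<noteq> {}" "card F \<le> m"
  obtains f :: "nat \<Rightarrow> 'a" where "f ` {..<m} = F"
proof -
  obtain h where h: "bij_betw h {0..<card F} F"
    using ex_bij_betw_nat_finite[OF assms(1)] by blast
  obtain x where "x \<in> F"
    using assms by blast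
  define f where "f i = (if i < card F then h i else x)" for i
  have "f ` {..<m} = F"
  proof
    show "f ` {..<m} \<subseteq> F"
      using h \<open>x \<in> F\<close> by (auto simp: f_def bij_betw_def)
    show "F \<subseteq> f ` {..<m}"
    proof
      fix y assume "y \<in> F"
      then obtain i where "i < card F" "y = h i"
        using h bij_betw_imp_surj_on by fastforce
      then show "y \<in> f ` {..<m}"
        using assms(3) by (auto simp: f_def intro!: image_eqI[of _ _ i])
    qed
  qed
  then show ?thesis by (rule that)
qed

text \<open>Converse of \<open>K_choosableI\<close>: \<open>T\<close> is the set of colours that a
  colouring uses on the right part. Colours may have any type, which allows structured colours
  below.\<close>

lemma K_choosable_separation:
  fixes F G :: "'c set set"
  assumes ch: "K_choosable m n k b"
    and F: "finite F" "F \<noteq> {}" "card F \<le> m" "\<And>X. X \<in> F \<Longrightarrow> finite X \<and> card X = k"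
    and G: "finite G" "G \<noteq> {}" "card G \<le> n" "\<And>Y. Y \<in> G \<Longrightarrow> finite Y \<and> card Y = b"
  obtains T where "\<And>X. X \<in> F \<Longrightarrow> \<not> X \<subseteq> T" "\<And>Y. Y \<in> G \<Longrightarrow> T \<inter> Y \<noteq> {}"
proof -
  obtain f where f: "f ` {..<m} = F"
    using finite_surj_lessThan F(1-3) .
  obtain g where g: "g ` {..<n} = G"
    using finite_surj_lessThan G(1-3) .
  let ?L = "case_sum f g"
  have "list_assignment (K_left m) (K_right n) k b UNIV ?L"
    using f g F(4) G(4) by (auto simp: list_assignment_def K_left_def K_right_def)
  then obtain c where c: "list_colouring (K_left m \<union> K_right n) (K_edges m n) ?L c"
    using choosable_any_colours[OF bipartite_graph_K] ch unfolding K_choosable_def by blast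
  define T where "T = c ` K_right n"
  show ?thesis
  proof (rule that)
    fix X assume "X \<in> F"
    then obtain i where i: "i < m" "X = f i"
      using f by auto
    then have "Inl i \<in> K_left m"
      by (simp add: K_left_def)
    then have "c (Inl i) \<noteq> c v" if "v \<in> K_right n" for v
      using c i that unfolding list_colouring_def K_edges_def by force
    moreover have "c (Inl i) \<in> X"
      using c i \<open>Inl i \<in> K_left m\<close> unfolding list_colouring_def by force
    ultimately show "\<not> X \<subseteq> T"
      unfolding T_def by auto
  next
    fix Y assume "Y \<in> G"
    then obtain j where j: "j < n" "Y = g j"
      using g by auto
    then have "Inr j \<in> K_right n"
      by (simp add: K_right_def)
    then have "c (Inr j) \<in> T \<inter> Y"
      using c j unfolding T_def list_colouring_def by force
    then show "T \<inter> Y \<noteq> {}" by blast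
  qed
qed

subsection \<open>Block construction of uncolourable lists\<close>

lemma not_K_choosable_blocks:
  assumes "k > 0" "g > 0" "s > 0"
    and n: "k ^ g \<le> n" and m: "g * (k * s choose k) \<le> m" and b: "b \<le> g * s"
  shows "\<not> K_choosable m n k b"
proof
  assume ch: "K_choosable m n k b"
  \<comment> \<open>The triple \<open>(i, j, l)\<close> is colour \<open>l\<close> of block
    \<open>j\<close> in group \<open>i\<close>.\<close>
  define grp :: "nat \<Rightarrow> (nat \<times> nat \<times> nat) set" where "grp i = {i} \<times> {..<k} \<times> {..<s}" for i
  define F where "F = (\<Union>i<g. {X. X \<subseteq> grp i \<and> card X = k})"
  define W :: "(nat \<Rightarrow> nat) \<Rightarrow> (nat \<times> nat \<times> nat) set"
    where "W h = (SIGMA i:{..<g}. {h i} \<times> {..<s})" for h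
  have card_W: "card (W h) = g * s" for h
    by (simp add: W_def card_SigmaI)
  \<comment> \<open>The selected blocks hold \<open>g * s\<close> colours in total, possibly more
    than \<open>b\<close>, so each union is trimmed to a list of exact size.\<close>
  have "\<forall>h. \<exists>Y. Y \<subseteq> W h \<and> card Y = b \<and> finite Y"
    using b card_W obtain_subset_with_card_n by metis
  then obtain Y where Y: "\<And>h. Y h \<subseteq> W h" "\<And>h. card (Y h) = b" "\<And>h. finite (Y h)"
    by metis
  define H where "H = ({..<g} \<rightarrow>\<^sub>E {..<k})"
  have H: "finite H" "H \<noteq> {}" "card H = k ^ g"
    using \<open>k > 0\<close> by (auto simp: H_def finite_PiE card_PiE PiE_eq_empty_iff)
  have fin_grp: "finite (grp i)" and card_grp: "card (grp i) = k * s" for i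
    by (simp_all add: grp_def card_cartesian_product)
  have 1: "finite F"
    using fin_grp by (auto simp: F_def)
  have 2: "F \<noteq> {}"
  proof -
    have "k \<le> card (grp 0)"
      using \<open>s > 0\<close> by (simp add: card_grp)
    then obtain X where "X \<subseteq> grp 0" "card X = k"
      by (rule obtain_subset_with_card_n)
    then show ?thesis
      using \<open>g > 0\<close> by (auto simp: F_def)
  qed
  have "card F \<le> (\<Sum>i<g. card {X. X \<subseteq> grp i \<and> card X = k})"
    unfolding F_def by (rule card_UN_le) simp
  also have "\<dots> = g * (k * s choose k)"
    by (simp add: n_subsets[OF fin_grp] card_grp)
  finally have 3: "card F \<le> m"
    using m by simp
  have 4: "finite X \<and> card X = k" if "X \<in> F" for X
    using that fin_grp finite_subset by (auto simp: F_def)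
  have 5: "card (Y ` H) \<le> n"
    using card_image_le[OF H(1), of Y] H(3) n by simp
  have 6: "finite (Y ` H)" "Y ` H \<noteq> {}" "\<And>Z. Z \<in> Y ` H \<Longrightarrow> finite Z \<and> card Z = b"
    using H(1,2) Y(2,3) by auto
  obtain T where "\<And>X. X \<in> F \<Longrightarrow> \<not> X \<subseteq> T" "\<And>Z. Z \<in> Y ` H \<Longrightarrow> T \<inter> Z \<noteq> {}"
    using K_choosable_separation[OF ch 1 2 3 4 6(1,2) 5 6(3)] by blast
  then have T: "\<And>X. X \<in> F \<Longrightarrow> \<not> X \<subseteq> T" "\<And>h. h \<in> H \<Longrightarrow> T \<inter> Y h \<noteq> {}"
    by auto
  \<comment> \<open>If \<open>T\<close> met every block of group \<open>i\<close>, one common colour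
    from each block would form a list of \<open>F\<close> inside \<open>T\<close>.\<close>
  have "\<exists>j<k. \<forall>l<s. (i, j, l) \<notin> T" if "i < g" for i
  proof (rule ccontr)
    assume "\<not> ?thesis"
    then obtain l where l: "\<And>j. j < k \<Longrightarrow> l j < s \<and> (i, j, l j) \<in> T"
      by metis
    let ?X = "(\<lambda>j. (i, j, l j)) ` {..<k}"
    have "card ?X = k"
      by (subst card_image) (auto simp: inj_on_def)
    moreover have "?X \<subseteq> grp i"
      using l by (auto simp: grp_def)
    ultimately have "?X \<in> F"
      using that unfolding F_def by blast
    then show False
      using T(1) l by blast
  qed
  then obtain h where h: "\<And>i. i < g \<Longrightarrow> h i < k \<and> (\<forall>l<s. (i, h i, l) \<notin> T)"
    by metis
  let ?h = "restrict h {..<g}"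
  have "?h \<in> H"
    using h by (auto simp: H_def)
  moreover have "T \<inter> W ?h = {}"
    using h by (auto simp: W_def)
  ultimately show False
    using T(2) Y(1)[of ?h] by blast
qed

subsection \<open>The two bounds\<close>

lemma K_choosable_if_small:
  assumes "k > 0" "b > 0" "k \<le> n" "b \<le> m"
    and small: "real m * ln n ^ (k - 1) / real b ^ k < 1 / (2 * 8 ^ k)"
  shows "K_choosable m n k b"
proof -
  \<comment> \<open>With this \<open>x\<close>, \<xi> equals \<open>(m / b) * x ^ (k - 1)\<close>.
    Since \<open>b \<le> m\<close>, a small \<xi> forces \<open>x\<close> to be small, which makes
    \<open>p = 8 * x\<close> a probability.\<close>
  define x where "x = ln (real n) / real b"
  have n1: "n \<ge> 1" using assms by linarith
  have x0: "x \<ge> 0"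
    using n1 by (simp add: x_def)
  have kS: "y ^ k = y * y ^ (k - 1)" for y :: real
    using \<open>k > 0\<close> by (simp add: power_eq_if)
  have xi: "real m * ln n ^ (k - 1) / real b ^ k = (real m / b) * x ^ (k - 1)"
    by (simp add: x_def power_divide kS)
  have "x ^ (k - 1) \<le> (real m / b) * x ^ (k - 1)"
    using x0 assms mult_right_mono[of 1 "real m / b" "x ^ (k - 1)"] by simp
  then have x_small: "x ^ (k - 1) < 1 / (2 * 8 ^ k)"
    using small xi by linarith
  also have "\<dots> \<le> (1/8) ^ (k - 1)"
    by (simp add: kS power_one_over field_simps)
  finally have "x < 1 / 8"
    using power_less_imp_less_base by fastforce
  \<comment> \<open>For \<open>k = 1\<close> the power of \<open>x\<close> is 1, contradicting its
    bound. Hence \<open>n\<close> is at least 2 and \<open>t\<close> is positive.\<close>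
  have "k \<noteq> 1"
  proof
    assume "k = 1"
    then show False using x_small by simp
  qed
  then have n2: "n \<ge> 2" using assms by linarith
  then have ln0: "ln (real n) > 0" by simp
  \<comment> \<open>The factor 8 makes \<open>(1 - p / 2) ^ b\<close> at most \<open>n\<close> to
    the power -4, which beats \<open>n\<close> lists times \<open>2 powr t = n\<close>.\<close>
  define p where "p = 8 * x"
  define t where "t = log 2 (real n)"
  have pt: "0 \<le> p" "p \<le> 1" "t > 0"
    using x0 \<open>x < 1/8\<close> n2 by (simp_all add: p_def t_def)
  have powt: "2 powr t = real n"
    using n2 by (simp add: t_def)
  have "(1 - p / 2) ^ b \<le> exp (- (p / 2)) ^ b"
    using pt exp_ge_add_one_self[of "- (p / 2)"] by (intro power_mono) auto
  also have "\<dots> = exp (- (4 * ln (real n)))"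
    using \<open>b > 0\<close> by (simp add: exp_of_nat_mult[symmetric] p_def x_def)
  also have "\<dots> = 1 / real n ^ 4"
    using n2 by (simp add: exp_minus exp_of_nat_mult[of 4, simplified] inverse_eq_divide)
  finally have "real n * 2 powr t * (1 - p / 2) ^ b \<le> real n * real n * (1 / real n ^ 4)"
    unfolding powt by (intro mult_left_mono) auto
  also have "\<dots> = (1 / real n) ^ 2"
    using n2 by (simp add: field_simps eval_nat_numeral)
  also have "\<dots> \<le> (1 / 2) ^ 2"
    using n2 by (intro power_mono) (auto simp: field_simps)
  finally have 1: "real n * 2 powr t * (1 - p / 2) ^ b \<le> 1 / 4"
    by (simp add: power2_eq_square)
  \<comment> \<open>Division by \<open>t\<close> cancels one factor \<open>ln n\<close> of
    \<open>p ^ k\<close>; this is where the exponent \<open>k - 1\<close> comes from.\<close>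
  have "real m * p ^ k / t = ln 2 * (8 ^ k * ((real m / b) * x ^ (k - 1)))"
    using ln0 \<open>b > 0\<close> by (simp add: p_def t_def log_def power_mult_distrib kS[of x]) (simp add: x_def)
  also have "\<dots> \<le> 1 * (8 ^ k * (1 / (2 * 8 ^ k)))"
    using small x0 ln_2_less_1 unfolding xi by (intro mult_mono) auto
  finally have 2: "real m * p ^ k / t \<le> 1 / 2"
    by simp
  show ?thesis
  proof (rule K_choosableI)
    fix L :: "nat + nat \<Rightarrow> nat set"
    assume L: "list_assignment (K_left m) (K_right n) k b UNIV L"
    let ?U = "\<Union>v\<in>K_left m \<union> K_right n. L v"
    have fin: "finite (K_left m)" "finite (K_right n)"
      by (simp_all add: K_left_def K_right_def)
    show "\<exists>T. (\<forall>v\<in>K_left m. \<not> L v \<subseteq> T) \<and> (\<forall>v\<in>K_right n. T \<inter> L v \<noteq> {})"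
    proof (rule exists_separating_set[of ?U "K_left m" "K_right n" L k L b p t])
      show "finite ?U"
        using L fin by (auto simp: list_assignment_def)
      show "real (card (K_right n)) * 2 powr t * (1 - p / 2) ^ b
          + real (card (K_left m)) * p ^ k / t < 1"
        using 1 2 by (simp add: card_K_left card_K_right)
    qed (use L fin pt \<open>k > 0\<close> in \<open>auto simp: list_assignment_def\<close>)
  qed
qed

text \<open>The constant combines the estimates \<open>s \<le> 2 * b / g\<close> and
  \<open>ln n \<le> 2 * ln k * g\<close>, each losing a factor 2 to rounding.\<close>

lemma not_K_choosable_if_large:
  assumes "k > 0" "b > 0" "k \<le> n" "b \<le> m"
    and large: "real m * ln n ^ (k - 1) / real b ^ k > (2 * k) ^ k * (2 * ln k) ^ (k - 1)"
  shows "\<not> K_choosable m n k b"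
proof (cases "k ^ b \<le> n")
  case True
  \<comment> \<open>With \<open>b\<close> groups of one-colour blocks only \<open>b \<le> m\<close> lists of size \<open>k\<close> are needed.
    This case includes \<open>k = 1\<close>.\<close>
  then show ?thesis
    using not_K_choosable_blocks[of k b 1 n m b] assms by simp
next
  case False
  then have "k \<noteq> 1"
    using assms by auto
  then have k2: "k \<ge> 2" using assms by linarith
  \<comment> \<open>\<open>g\<close> is the integer part of the logarithm of \<open>n\<close> to
    base \<open>k\<close>: the most groups for which \<open>n\<close> lists cover all block
    choices.\<close>
  obtain g where g: "k ^ g \<le> n" "n < k ^ (g + 1)"
    using ex_power_ivl1[of k n] k2 assms by auto
  have "g > 0"
    using g \<open>k \<le> n\<close> by (cases g) auto
  have "k ^ g < k ^ b"
    using g False by linarith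
  then have "g < b"
    using k2 by simp
  \<comment> \<open>Rounding up ensures \<open>g * s\<close> reaches \<open>b\<close>; as
    \<open>g < b\<close>, it stays within \<open>2 * b\<close>.\<close>
  define s where "s = b div g + 1"
  have "b \<le> g * s"
    using \<open>g > 0\<close> dividend_less_times_div[of g b] by (simp add: s_def)
  have "real s * g \<le> 2 * b"
  proof -
    have "s * g = g * (b div g) + g"
      by (simp add: s_def algebra_simps)
    also have "\<dots> \<le> 2 * b"
      using times_div_less_eq_dividend[of g b] \<open>g < b\<close> by linarith
    finally show ?thesis
      by (metis of_nat_le_iff of_nat_mult of_nat_numeral)
  qed
  then have s_le: "real s \<le> 2 * real b / g"
    using \<open>g > 0\<close> by (simp add: field_simps)
  have lnk: "ln (real k) > 0" using k2 by simp
  have "ln (real n) \<le> ln (real k ^ (g + 1))"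
    using g(2) assms by (subst ln_le_cancel_iff) (auto simp flip: of_nat_power of_nat_mult)
  also have "\<dots> = real (g + 1) * ln k"
    using k2 by (subst ln_realpow) auto
  also have "\<dots> \<le> 2 * g * ln k"
    using \<open>g > 0\<close> lnk by (intro mult_right_mono) auto
  finally have ln_n: "ln (real n) \<le> 2 * ln k * g"
    by (simp add: mult_ac)
  have pos: "0 < ln (real n)" using k2 assms by simp
  have kS: "y ^ k = y * y ^ (k - 1)" for y :: real
    using \<open>k > 0\<close> by (simp add: power_eq_if)
  have "real (g * (k * s choose k)) * ln n ^ (k - 1) \<le> g * (real k * s) ^ k * ln n ^ (k - 1)"
  proof -
    have "(k * s choose k) \<le> (k * s) ^ k"
      by (rule binomial_le_pow) (simp add: s_def)
    then have "real (k * s choose k) \<le> (real k * s) ^ k"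
      by (metis of_nat_le_iff of_nat_mult of_nat_power)
    then show ?thesis
      using pos by (auto intro!: mult_right_mono mult_left_mono)
  qed
  also have "\<dots> \<le> g * (real k * (2 * real b / g)) ^ k * (2 * ln k * g) ^ (k - 1)"
    using s_le ln_n pos lnk by (intro mult_mono power_mono mult_left_mono) auto
  \<comment> \<open>The powers of \<open>g\<close>, with exponents 1, -k and k - 1, cancel.\<close>
  also have "\<dots> = (2 * k) ^ k * (2 * ln k) ^ (k - 1) * b ^ k"
    using \<open>g > 0\<close> by (simp add: power_mult_distrib power_divide kS[of g])
  also have "\<dots> < real m * ln n ^ (k - 1)"
    using large \<open>b > 0\<close> by (simp add: field_simps)
  finally have "g * (k * s choose k) \<le> m"
    using pos by (simp del: of_nat_mult)
  then show ?thesis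
    using not_K_choosable_blocks[of k g s n m b] assms g \<open>g > 0\<close> \<open>b \<le> g * s\<close> by (simp add: s_def)
qed

theorem theorem1p4:
  fixes kA :: nat
  assumes "kA > 0"
  shows "\<exists>C1 C2 :: real. C1 > 0 \<and> C2 > 0 \<and>
    (\<forall>kB \<Delta>A \<Delta>B :: nat. kB > 0 \<longrightarrow> \<Delta>A > 0 \<longrightarrow> \<Delta>B > 0 \<longrightarrow> \<Delta>A \<ge> kA \<longrightarrow> \<Delta>B \<ge> kB \<longrightarrow>
      (let \<xi> = real \<Delta>B * ln (real \<Delta>A) ^ (kA - 1) / real kB ^ kA in
         (\<xi> < C1 \<longrightarrow> K_choosable \<Delta>B \<Delta>A kA kB) \<and>
         (\<xi> > C2 \<longrightarrow> \<not> K_choosable \<Delta>B \<Delta>A kA kB)))"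
proof -
  \<comment> \<open>For \<open>kA = 1\<close> the logarithm is 0, but its exponent is 0 too, so the
    constant stays positive.\<close>
  have "(2 * real kA) ^ kA * (2 * ln kA) ^ (kA - 1) > 0"
    using assms by (cases "kA = 1") auto
  then show ?thesis
    using K_choosable_if_small[OF assms] not_K_choosable_if_large[OF assms]
    by (intro exI[of _ "1 / (2 * 8 ^ kA)"] exI[of _ "(2 * kA) ^ kA * (2 * ln kA) ^ (kA - 1)"])
       (auto simp: Let_def)
qed

end
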